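(* Let $D_0$ be a two-row diagram whose nonempty rows are $r_1<r_2$. Then $\mathcal{P}(D_0)$ is ranked if and only if either (a) $r_1=1$, or (b) $r_1>1$, $\mathrm{Col}^{\rightarrow}(D_0;r_1)\cup\mathrm{Col}^{\rightarrow}(D_0;r_2)=\emptyset$, and $|\mathrm{Col}(D_0;r_1,r_2)|\le 1$. Moreover, in that case a rank function is given by $rk(D)=rowsum(D)-b(D_0)$ for $D\in KD(D_0)$.
   Context: A diagram is a finite set $D$ of cells $(r,c)$ with $r,c$ positive integers; $r$ is the row (rows numbered from bottom to top starting at 1) and $c$ the column (numbered from left to right starting at 1). A Kohnert move at row $r$ applied to a diagram $D$: if row $r$ of $D$ is empty, $D$ is unchanged; otherwise let $(r,c)$ be the cell of row $r$ with the largest column index; if every position $(r',c)$ with $1\le r'<r$ belongs to $D$, then $D$ is unchanged; otherwise let $r'$ be the largest integer with $1\le r'<r$ and $(r',c)\notin D$, and the move replaces the cell $(r,c)$ by $(r',c)$. For a diagram $D_0$, $KD(D_0)$ is the set of all diagrams obtainable from $D_0$ by finite (possibly empty) sequences of Kohnert moves; the Kohnert poset $\mathcal{P}(D_0)$ is $KD(D_0)$ ordered by $D_2\preceq D_1$ iff $D_2$ can be obtained from $D_1$ by a finite sequence of Kohnert moves; $Min(D_0)$ is its set of minimal elements. $rowsum(D)=\sum_{(r,c)\in D}r$ and $b(D_0)=\min\{rowsum(T):T\in Min(D_0)\}$. A finite poset $P$ is ranked if there is a function $\rho:P\to\mathbb{Z}_{\ge0}$ such that $x\prec y$ implies $\rho(x)<\rho(y)$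 and $\rho(y)=\rho(x)+1$ whenever $y$ covers $x$. A two-row diagram is a diagram with exactly two nonempty rows (not necessarily consecutive). For such $D_0$ with nonempty rows $r_1<r_2$: $\mathrm{Col}(D_0;r_1,r_2)$ is the set of columns containing cells in both rows; for $i=1,2$, $\mathrm{Col}(D_0;r_i)$ is the set of columns containing a cell only in row $r_i$, and $\mathrm{Col}^{\rightarrow}(D_0;r_i)=\{c\in\mathrm{Col}(D_0;r_i): c>\max\mathrm{Col}(D_0;r_1,r_2)\}$, taken to be empty when $\mathrm{Col}(D_0;r_1,r_2)=\emptyset$. *)

theory Defs
  imports Main
begin

text \<open>A cell \<open>(r, c)\<close> lies in row \<open>r\<close> (rows are numbered from bottom to top) and column \<open>c\<close>.\<close>

type_synonym diagram = "(nat \<times> nat) set"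

definition is_diagram :: "diagram \<Rightarrow> bool" where
  "is_diagram D \<longleftrightarrow> finite D \<and> (\<forall>(r, c) \<in> D. 1 \<le> r \<and> 1 \<le> c)"

definition row :: "diagram \<Rightarrow> nat \<Rightarrow> nat set" where
  "row D r = {c. (r, c) \<in> D}"

definition free_below :: "diagram \<Rightarrow> nat \<Rightarrow> nat \<Rightarrow> nat set" where
  "free_below D r c = {r'. 1 \<le> r' \<and> r' < r \<and> (r', c) \<notin> D}"

definition kohnert_move :: "nat \<Rightarrow> diagram \<Rightarrow> diagram" where
  "kohnert_move r D =
     (if row D r = {} then D
      else let c = Max (row D r) in
        if free_below D r c = {} then D
        else insert (Max (free_below D r c), c) (D - {(r, c)}))"

definition kohnert_step :: "diagram \<Rightarrow> diagram \<Rightarrow> bool" where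
  "kohnert_step D D' \<longleftrightarrow> (\<exists>r\<ge>1. D' = kohnert_move r D)"

definition KD :: "diagram \<Rightarrow> diagram set" where
  "KD D0 = {D. kohnert_step\<^sup>*\<^sup>* D0 D}"

text \<open>As usual for order relations in HOL, \<open>(D2, D1) \<in> kohnert_le D0\<close> means that
  \<open>D2\<close> is below \<open>D1\<close>; the Kohnert poset of \<open>D0\<close> is \<open>KD D0\<close> with this relation.\<close>

definition kohnert_le :: "diagram \<Rightarrow> diagram rel" where
  "kohnert_le D0 = {(D2, D1). D2 \<in> KD D0 \<and> D1 \<in> KD D0 \<and> kohnert_step\<^sup>*\<^sup>* D1 D2}"

definition strictly_below :: "'a rel \<Rightarrow> 'a \<Rightarrow> 'a \<Rightarrow> bool" where
  "strictly_below le x y \<longleftrightarrow> (x, y) \<in> le \<and> x \<noteq> y"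

definition covered_by :: "'a set \<Rightarrow> 'a rel \<Rightarrow> 'a \<Rightarrow> 'a \<Rightarrow> bool" where
  "covered_by P le x y \<longleftrightarrow>
     strictly_below le x y \<and> \<not> (\<exists>z\<in>P. strictly_below le x z \<and> strictly_below le z y)"

definition minimal_elements :: "'a set \<Rightarrow> 'a rel \<Rightarrow> 'a set" where
  "minimal_elements P le = {x \<in> P. \<not> (\<exists>y\<in>P. strictly_below le y x)}"

text \<open>Rank functions take integer values, required to be nonnegative on \<open>P\<close>, so that a
  difference can serve as a rank function without truncated subtraction.\<close>

definition is_rank_function :: "'a set \<Rightarrow> 'a rel \<Rightarrow> ('a \<Rightarrow> int) \<Rightarrow> bool" where
  "is_rank_function P le \<rho> \<longleftrightarrow>
     (\<forall>x\<in>P. 0 \<le> \<rho> x) \<and>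
     (\<forall>x\<in>P. \<forall>y\<in>P. strictly_below le x y \<longrightarrow> \<rho> x < \<rho> y) \<and>
     (\<forall>x\<in>P. \<forall>y\<in>P. covered_by P le x y \<longrightarrow> \<rho> y = \<rho> x + 1)"

definition ranked :: "'a set \<Rightarrow> 'a rel \<Rightarrow> bool" where
  "ranked P le \<longleftrightarrow> (\<exists>\<rho>. is_rank_function P le \<rho>)"

definition Min_KD :: "diagram \<Rightarrow> diagram set" where
  "Min_KD D0 = minimal_elements (KD D0) (kohnert_le D0)"

definition rowsum :: "diagram \<Rightarrow> nat" where
  "rowsum D = (\<Sum>(r, c)\<in>D. r)"

definition b :: "diagram \<Rightarrow> nat" where
  "b D0 = Min (rowsum ` Min_KD D0)"

definition rk :: "diagram \<Rightarrow> diagram \<Rightarrow> int" where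
  "rk D0 D = int (rowsum D) - int (b D0)"

definition nonempty_rows :: "diagram \<Rightarrow> nat set" where
  "nonempty_rows D = {r. row D r \<noteq> {}}"

definition two_row_diagram :: "diagram \<Rightarrow> nat \<Rightarrow> nat \<Rightarrow> bool" where
  "two_row_diagram D r1 r2 \<longleftrightarrow> is_diagram D \<and> r1 < r2 \<and> nonempty_rows D = {r1, r2}"

definition Col_both :: "diagram \<Rightarrow> nat \<Rightarrow> nat \<Rightarrow> nat set" where
  "Col_both D r1 r2 = row D r1 \<inter> row D r2"

definition Col_only :: "diagram \<Rightarrow> nat \<Rightarrow> nat set" where
  "Col_only D r = {c. (r, c) \<in> D \<and> (\<forall>r'. r' \<noteq> r \<longrightarrow> (r', c) \<notin> D)}"

text \<open>The last argument \<open>r\<close> is meant to be one of \<open>r1\<close>, \<open>r2\<close>.\<close>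

definition Col_right :: "diagram \<Rightarrow> nat \<Rightarrow> nat \<Rightarrow> nat \<Rightarrow> nat set" where
  "Col_right D r1 r2 r =
     (if Col_both D r1 r2 = {} then {}
      else {c \<in> Col_only D r. c > Max (Col_both D r1 r2)})"

lemma kohnert_move_rowsum:
  assumes "finite D"
  shows "kohnert_move r D = D \<or> rowsum (kohnert_move r D) < rowsum D"
proof (cases "kohnert_move r D = D")
  case False
  define c where "c = Max (row D r)"
  define q where "q = Max (free_below D r c)"
  have eq: "row D r \<noteq> {}" "free_below D r c \<noteq> {}"
    "kohnert_move r D = insert (q, c) (D - {(r, c)})"
    using False by (auto simp: kohnert_move_def Let_def c_def q_def split: if_splits)
  have "row D r \<subseteq> snd ` D" by (force simp: row_def)
  then have "finite (row D r)" using assms finite_surj by blast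
  then have mem: "(r, c) \<in> D" using Max_in eq(1) by (auto simp: c_def row_def)
  have "finite (free_below D r c)" by (auto simp: free_below_def)
  then have q: "q < r" "(q, c) \<notin> D"
    using Max_in[OF _ eq(2)] by (auto simp: q_def free_below_def)
  show ?thesis
    using assms q sum.remove[OF assms mem, of "\<lambda>(r, c). r"]
    by (simp add: eq(3) rowsum_def)
qed simp

lemma finite_kohnert_move: "finite D \<Longrightarrow> finite (kohnert_move r D)"
  by (simp add: kohnert_move_def Let_def)

lemma kohnert_steps_rowsum:
  assumes "kohnert_step\<^sup>*\<^sup>* D E" "finite D"
  shows "finite E \<and> (E = D \<or> rowsum E < rowsum D)"
  using assms
proof (induction rule: rtranclp_induct)
  case (step E F)
  from step.hyps(2) obtain r where F: "F = kohnert_move r E"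
    unfolding kohnert_step_def by blast
  have E: "finite E" "E = D \<or> rowsum E < rowsum D"
    using step.IH step.prems by auto
  have "F = E \<or> rowsum F < rowsum E"
    unfolding F by (rule kohnert_move_rowsum[OF E(1)])
  moreover have "finite F"
    unfolding F by (rule finite_kohnert_move[OF E(1)])
  ultimately show ?case using E(2) by auto
qed simp

lemma partial_order_on_kohnert_le:
  assumes "is_diagram D0"
  shows "partial_order_on (KD D0) (kohnert_le D0)"
proof -
  have fin: "finite D" if "D \<in> KD D0" for D
    using that assms kohnert_steps_rowsum[of D0 D] by (auto simp: KD_def is_diagram_def)
  have "antisym (kohnert_le D0)"
  proof (rule antisymI)
    fix D E
    assume "(D, E) \<in> kohnert_le D0" "(E, D) \<in> kohnert_le D0"
    then have *: "finite D" "finite E" "kohnert_step\<^sup>*\<^sup>* E D" "kohnert_step\<^sup>*\<^sup>* D E"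
      using fin by (auto simp: kohnert_le_def)
    show "D = E"
      using kohnert_steps_rowsum[OF *(3,2)] kohnert_steps_rowsum[OF *(4,1)] by auto
  qed
  moreover have "trans (kohnert_le D0)"
    by (intro transI) (auto simp: kohnert_le_def)
  moreover have "refl_on (KD D0) (kohnert_le D0)"
    by (auto simp: refl_on_def kohnert_le_def)
  ultimately show ?thesis
    by (auto simp: partial_order_on_def preorder_on_def kohnert_le_def)
qed

end

(* Work with rowsum.  A nontrivial move pushes the last cell (r, c) of row r down to a
   position (q, c), with all positions strictly between occupied, and lowers rowsum by r - q.
   If r > q + 1 and no cell of row q + 1 lies to the right of column c, the move factors as
   (q + 1, c) to (q, c) followed by (r, c) to (q + 1, c), so it is not a cover.  In cases (a)
   and (b) this applies to every move with r > q + 1, so rowsum drops by exactly 1 along covers.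

   Otherwise there are a column a meeting both rows and a cell to the right of a.  Lower the
   upper row to row n + 1, where n = r1.  As n > 1, two descents from there reach the same
   diagram: one consists of unit drops only, the other contains a single drop of (n + 1, a)
   to (n - 1, a), which is a cover because a cell of row n to the right of a prevents
   (n, a) from moving first.  The two saturated chains differ in length. *)

theory Submission
  imports Defs
begin

section \<open>Kohnert moves as drops\<close>

definition drop_cell :: "diagram \<Rightarrow> nat \<Rightarrow> nat \<Rightarrow> nat \<Rightarrow> diagram" where
  "drop_cell D r q c = insert (q, c) (D - {(r, c)})"

text \<open>A relational form of the nontrivial moves: the two uses of \<open>Max\<close> become
  order conditions, so a proposed move can be checked cell by cell.\<close>

definition can_drop :: "diagram \<Rightarrow> nat \<Rightarrow> nat \<Rightarrow> nat \<Rightarrow> bool" where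
  "can_drop D r q c \<longleftrightarrow>
     (r, c) \<in> D \<and> (\<forall>d. (r, d) \<in> D \<longrightarrow> d \<le> c) \<and>
     1 \<le> q \<and> q < r \<and> (q, c) \<notin> D \<and> (\<forall>p. q < p \<longrightarrow> p < r \<longrightarrow> (p, c) \<in> D)"

lemma finite_row: "finite D \<Longrightarrow> finite (row D r)"
proof -
  assume "finite D"
  moreover have "row D r \<subseteq> snd ` D" by (force simp: row_def)
  ultimately show ?thesis using finite_surj by blast
qed

lemma finite_free_below: "finite (free_below D r c)"
  by (auto simp: free_below_def)

lemma can_drop_step:
  assumes "finite D" "can_drop D r q c"
  shows "kohnert_step D (drop_cell D r q c)"
proof -
  have c: "Max (row D r) = c"
    using assms finite_row[OF assms(1), of r] by (intro Max_eqI) (auto simp: row_def can_drop_def)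
  have q: "Max (free_below D r c) = q"
    using assms finite_free_below[of D r c]
    by (intro Max_eqI) (auto simp: can_drop_def free_below_def not_less[symmetric])
  have "row D r \<noteq> {}" "free_below D r c \<noteq> {}"
    using assms by (auto simp: can_drop_def row_def free_below_def)
  then have "kohnert_move r D = drop_cell D r q c"
    by (simp add: kohnert_move_def c q drop_cell_def)
  moreover have "1 \<le> r" using assms by (auto simp: can_drop_def)
  ultimately show ?thesis unfolding kohnert_step_def by metis
qed

lemma step_drop:
  assumes "finite D" "kohnert_step D D'" "D' \<noteq> D"
  obtains r q c where "can_drop D r q c" "D' = drop_cell D r q c"
proof -
  obtain r where r: "D' = kohnert_move r D" using assms by (auto simp: kohnert_step_def)
  define c where "c = Max (row D r)"
  define q where "q = Max (free_below D r c)"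
  have eq: "row D r \<noteq> {}" "free_below D r c \<noteq> {}" "D' = drop_cell D r q c"
    using assms(3) unfolding r
    by (auto simp: kohnert_move_def Let_def c_def q_def drop_cell_def split: if_splits)
  have "c \<in> row D r" "\<forall>d\<in>row D r. d \<le> c"
    using Max_in[OF finite_row[OF assms(1)] eq(1)] Max_ge[OF finite_row[OF assms(1)]]
    by (simp_all add: c_def)
  moreover have "q \<in> free_below D r c" "\<forall>p\<in>free_below D r c. p \<le> q"
    using Max_in[OF finite_free_below eq(2)] Max_ge[OF finite_free_below]
    by (simp_all add: q_def)
  moreover have "(p, c) \<in> D" if "q < p" "p < r" for p
  proof (rule ccontr)
    assume "(p, c) \<notin> D"
    then have "p \<in> free_below D r c" using that by (auto simp: free_below_def)
    then have "p \<le> q" using Max_ge[OF finite_free_below] by (simp add: q_def)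
    then show False using that by simp
  qed
  ultimately have "can_drop D r q c"
    by (auto simp: can_drop_def row_def free_below_def)
  then show ?thesis using that eq(3) by blast
qed

lemma rowsum_drop_cell:
  assumes "finite D" "can_drop D r q c"
  shows "rowsum (drop_cell D r q c) + (r - q) = rowsum D"
  using assms sum.remove[of D "(r, c)" "\<lambda>(r, c). r"]
  by (auto simp: rowsum_def drop_cell_def can_drop_def)

section \<open>The Kohnert poset\<close>

lemma KD_refl: "D \<in> KD D"
  by (simp add: KD_def)

lemma KD_step: "D \<in> KD D0 \<Longrightarrow> kohnert_step D E \<Longrightarrow> E \<in> KD D0"
  by (simp add: KD_def)

lemma KD_finite: "finite D0 \<Longrightarrow> D \<in> KD D0 \<Longrightarrow> finite D"
  by (auto simp: KD_def dest: kohnert_steps_rowsum)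

lemma strictly_below_rowsum:
  assumes "finite D0" "strictly_below (kohnert_le D0) x y"
  shows "rowsum x < rowsum y"
  using assms KD_finite[OF assms(1)] kohnert_steps_rowsum[of y x]
  by (auto simp: strictly_below_def kohnert_le_def)

lemma step_strictly_below:
  "D \<in> KD D0 \<Longrightarrow> kohnert_step D E \<Longrightarrow> E \<noteq> D \<Longrightarrow> strictly_below (kohnert_le D0) E D"
  by (auto simp: strictly_below_def kohnert_le_def KD_step)

lemma strictly_below_first_step:
  assumes "finite D0" "strictly_below (kohnert_le D0) x y"
  obtains r q c where "can_drop y r q c" "drop_cell y r q c \<in> KD D0"
    "kohnert_step\<^sup>*\<^sup>* (drop_cell y r q c) x"
proof -
  have y: "y \<in> KD D0" "finite y" and "kohnert_step\<^sup>*\<^sup>* y x" "x \<noteq> y"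
    using assms by (auto simp: strictly_below_def kohnert_le_def KD_finite)
  \<comment> \<open>Trivial moves are steps too, so the chain may begin by repeating
    \<open>y\<close>; the induction skips to the first step that changes it.\<close>
  from this(3,4,2) have "\<exists>z. kohnert_step y z \<and> z \<noteq> y \<and> kohnert_step\<^sup>*\<^sup>* z x"
    by (induction rule: converse_rtranclp_induct) auto
  then obtain z where z: "kohnert_step y z" "z \<noteq> y" "kohnert_step\<^sup>*\<^sup>* z x" by blast
  obtain r q c where "can_drop y r q c" "z = drop_cell y r q c"
    using step_drop[OF y(2) z(1,2)] by blast
  then show ?thesis using that z KD_step[OF y(1) z(1)] by blast
qed

text \<open>The first nontrivial move on the way down from \<open>y\<close> must already reach
  \<open>x\<close>, since its result would otherwise lie strictly between them.\<close>

lemma covered_by_drop: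
  assumes "finite D0" "covered_by (KD D0) (kohnert_le D0) x y"
  obtains r q c where "can_drop y r q c" "x = drop_cell y r q c"
proof -
  have below: "strictly_below (kohnert_le D0) x y"
    using assms(2) by (simp add: covered_by_def)
  then have xy: "x \<in> KD D0" "y \<in> KD D0" by (auto simp: strictly_below_def kohnert_le_def)
  obtain r q c where z: "can_drop y r q c" "drop_cell y r q c \<in> KD D0"
    "kohnert_step\<^sup>*\<^sup>* (drop_cell y r q c) x"
    using strictly_below_first_step[OF assms(1) below] by blast
  have "drop_cell y r q c \<noteq> y" using z(1) by (auto simp: can_drop_def drop_cell_def)
  then have "strictly_below (kohnert_le D0) (drop_cell y r q c) y"
    using z(1) xy KD_finite[OF assms(1)] by (blast intro: step_strictly_below can_drop_step)
  then have "\<not> strictly_below (kohnert_le D0) x (drop_cell y r q c)"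
    using assms(2) z(2) by (auto simp: covered_by_def)
  then have "x = drop_cell y r q c"
    using z xy by (auto simp: strictly_below_def kohnert_le_def)
  then show ?thesis using that z by blast
qed

lemma unit_gap_covered_by:
  assumes "finite D0" "strictly_below (kohnert_le D0) E D" "rowsum D = rowsum E + 1"
  shows "covered_by (KD D0) (kohnert_le D0) E D"
proof -
  have "\<not> (strictly_below (kohnert_le D0) E z \<and> strictly_below (kohnert_le D0) z D)" for z
    using strictly_below_rowsum[OF assms(1), of E z] strictly_below_rowsum[OF assms(1), of z D]
      assms(3) by linarith
  then show ?thesis using assms(2) by (auto simp: covered_by_def)
qed

lemma unit_gap_drop:
  assumes "finite D0" "strictly_below (kohnert_le D0) E D" "rowsum D = rowsum E + 1"
  obtains q c where "can_drop D (q + 1) q c" "E = drop_cell D (q + 1) q c"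
proof -
  obtain r q c where *: "can_drop D r q c" "E = drop_cell D r q c"
    using covered_by_drop[OF assms(1) unit_gap_covered_by[OF assms]] by blast
  have "finite D"
    using assms(1,2) KD_finite by (auto simp: strictly_below_def kohnert_le_def)
  then have "r - q = 1" using rowsum_drop_cell[of D r q c] * assms(3) by simp
  then have "r = q + 1" by simp
  then show ?thesis using that * by blast
qed

lemma minimal_below:
  assumes "finite D0" "D \<in> KD D0"
  shows "\<exists>T\<in>Min_KD D0. rowsum T \<le> rowsum D"
  using assms(2)
proof (induction "rowsum D" arbitrary: D rule: less_induct)
  case less
  show ?case
  proof (cases "D \<in> Min_KD D0")
    case False
    then obtain E where E: "E \<in> KD D0" "strictly_below (kohnert_le D0) E D"
      using less.prems by (auto simp: Min_KD_def minimal_elements_def)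
    then have "rowsum E < rowsum D" using strictly_below_rowsum[OF assms(1)] by blast
    then show ?thesis using less.hyps[OF _ E(1)] by (meson le_trans less_imp_le)
  qed blast
qed

lemma rk_nonneg:
  assumes "finite D0" "D \<in> KD D0"
  shows "0 \<le> rk D0 D"
proof -
  \<comment> \<open>\<open>Min\<close> is informative only on finite sets. Bounding the rowsums by
    that of \<open>D0\<close> gives finiteness without counting \<open>KD D0\<close>.\<close>
  have "rowsum ` Min_KD D0 \<subseteq> {..rowsum D0}"
    using assms(1) by (force simp: Min_KD_def minimal_elements_def KD_def dest: kohnert_steps_rowsum)
  then have "finite (rowsum ` Min_KD D0)" using finite_subset by blast
  moreover obtain T where "T \<in> Min_KD D0" "rowsum T \<le> rowsum D"
    using minimal_below[OF assms] by blast
  ultimately have "b D0 \<le> rowsum D"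
    unfolding b_def using Min_le by (meson imageI le_trans)
  then show ?thesis by (simp add: rk_def)
qed

section \<open>A sufficient condition for rankedness\<close>

lemma long_drop_not_covered_by:
  assumes "finite D0" "y \<in> KD D0" "can_drop y r q c" "q + 1 < r"
    "\<forall>d. (q + 1, d) \<in> y \<longrightarrow> d \<le> c"
  shows "\<not> covered_by (KD D0) (kohnert_le D0) (drop_cell y r q c) y"
proof
  assume cov: "covered_by (KD D0) (kohnert_le D0) (drop_cell y r q c) y"
  define z where "z = drop_cell y (q + 1) q c"
  have y: "finite y" using KD_finite assms by blast
  have d1: "can_drop y (q + 1) q c"
    using assms by (auto simp: can_drop_def)
  have zy: "z \<noteq> y" using d1 by (auto simp: z_def drop_cell_def can_drop_def)
  have s1: "kohnert_step y z" unfolding z_def by (rule can_drop_step[OF y d1])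
  have z: "z \<in> KD D0" using KD_step s1 assms by blast
  \<comment> \<open>The first drop vacates \<open>(q + 1, c)\<close>, which thereby becomes the
    highest free position below \<open>(r, c)\<close>.\<close>
  have d2: "can_drop z r (q + 1) c"
    using assms(3,4) by (auto simp: can_drop_def z_def drop_cell_def)
  have eq: "drop_cell z r (q + 1) c = drop_cell y r q c"
    using assms(3,4) by (auto simp: can_drop_def z_def drop_cell_def)
  have s2: "kohnert_step z (drop_cell y r q c)"
    using can_drop_step[OF KD_finite[OF assms(1) z] d2] eq by simp
  have "(q + 1, c) \<in> drop_cell y r q c" "(q + 1, c) \<notin> z"
    using assms(3,4) by (auto simp: can_drop_def z_def drop_cell_def)
  then have "drop_cell y r q c \<noteq> z" by blast
  then have "strictly_below (kohnert_le D0) (drop_cell y r q c) z"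
    using step_strictly_below[OF z s2] by blast
  moreover have "strictly_below (kohnert_le D0) z y"
    using step_strictly_below[OF assms(2) s1 zy] .
  ultimately show False using cov z by (auto simp: covered_by_def)
qed

lemma rk_is_rank_function:
  assumes "finite D0"
    and long: "\<And>D r q c d. D \<in> KD D0 \<Longrightarrow> can_drop D r q c \<Longrightarrow> q + 1 < r \<Longrightarrow>
      (q + 1, d) \<in> D \<Longrightarrow> d \<le> c"
  shows "is_rank_function (KD D0) (kohnert_le D0) (rk D0)"
  unfolding is_rank_function_def
proof (intro conjI ballI impI)
  fix x y assume xy: "x \<in> KD D0" "y \<in> KD D0"
  show "0 \<le> rk D0 x" using rk_nonneg assms(1) xy by blast
  show "rk D0 x < rk D0 y" if "strictly_below (kohnert_le D0) x y"
    using strictly_below_rowsum[OF assms(1) that] by (simp add: rk_def)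
  assume cov: "covered_by (KD D0) (kohnert_le D0) x y"
  then obtain r q c where *: "can_drop y r q c" "x = drop_cell y r q c"
    using covered_by_drop[OF assms(1)] by blast
  have "\<not> q + 1 < r"
    using long_drop_not_covered_by[OF assms(1) xy(2) *(1)] cov long[OF xy(2) *(1)] *(2) by blast
  then have "r - q = 1" using *(1) by (auto simp: can_drop_def)
  then show "rk D0 y = rk D0 x + 1"
    using rowsum_drop_cell[OF KD_finite[OF assms(1) xy(2)] *(1)] *(2) by (simp add: rk_def)
qed

section \<open>Column invariants for the two ranked cases\<close>

lemma KD_invariant:
  assumes "finite D0" "D \<in> KD D0" "I D0"
    and "\<And>D r q c. finite D \<Longrightarrow> I D \<Longrightarrow> can_drop D r q c \<Longrightarrow> I (drop_cell D r q c)"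
  shows "I D"
proof -
  have "kohnert_step\<^sup>*\<^sup>* D0 D" using assms(2) by (simp add: KD_def)
  then show ?thesis
  proof (induction rule: rtranclp_induct)
    case (step E F)
    have "finite E" using KD_finite[OF assms(1)] step by (auto simp: KD_def)
    then show ?case using step assms(4) step_drop[of E F] by metis
  qed (rule assms(3))
qed

text \<open>If the lower of any two cells of a column lies in row 1, no drop is longer than one row:
  it would pass an occupied \<open>(q + 1, c)\<close> below \<open>(r, c)\<close>, forcing
  \<open>q = 0\<close>. Drops preserve the condition.\<close>

lemma rank_function_if_bottom_row:
  assumes "finite D0"
    and "\<And>p q c. (p, c) \<in> D0 \<Longrightarrow> (q, c) \<in> D0 \<Longrightarrow> p < q \<Longrightarrow> p = 1"
  shows "is_rank_function (KD D0) (kohnert_le D0) (rk D0)"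
proof (rule rk_is_rank_function[OF assms(1)])
  fix D r q c d
  assume D: "D \<in> KD D0" and dr: "can_drop D r q c" "q + 1 < r"
  let ?I = "\<lambda>D. \<forall>p q c. (p, c) \<in> D \<longrightarrow> (q, c) \<in> D \<longrightarrow> p < q \<longrightarrow> p = 1"
  have "?I D"
  proof (rule KD_invariant[OF assms(1) D])
    fix D r q c assume I: "?I D" and dr: "can_drop D r q c"
    have *: "(r, c) \<in> D" "1 \<le> q" "q < r" using dr by (auto simp: can_drop_def)
    have "p = 1" if "(p, c) \<in> D" "p < q" for p
      using I that * by (meson less_trans)
    \<comment> \<open>Another cell of the column above row \<open>q\<close> is excluded: below
      \<open>(r, c)\<close> it would lie in row 1, and above it would force \<open>r = 1\<close>;
      both contradict \<open>1 \<le> q < r\<close>.\<close>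
    moreover have False if "(p, c) \<in> D" "q < p" "p \<noteq> r" for p
      using I[rule_format, of p c r] I[rule_format, of r c p] that * by linarith
    ultimately show "?I (drop_cell D r q c)"
      using I by (simp add: drop_cell_def) blast
  qed (use assms in blast)
  moreover have "(q + 1, c) \<in> D" "(r, c) \<in> D" "1 \<le> q"
    using dr by (auto simp: can_drop_def)
  ultimately show "d \<le> c" using dr by fastforce
qed

text \<open>Drops keep each cell in its column, so they preserve the condition that no cell lies to
  the right of a column with two cells. A long drop passes a second cell of its own column, so
  nothing lies to its right.\<close>

lemma rank_function_if_double_rightmost:
  assumes "finite D0"
    and "\<And>p q c s d. (p, c) \<in> D0 \<Longrightarrow> (q, c) \<in> D0 \<Longrightarrow> p \<noteq> q \<Longrightarrow> (s, d) \<in> D0 \<Longrightarrow> d \<le> c"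
  shows "is_rank_function (KD D0) (kohnert_le D0) (rk D0)"
proof (rule rk_is_rank_function[OF assms(1)])
  fix D r q c d
  assume D: "D \<in> KD D0" and dr: "can_drop D r q c" "q + 1 < r" "(q + 1, d) \<in> D"
  let ?I = "\<lambda>D. \<forall>p q c s d. (p, c) \<in> D \<longrightarrow> (q, c) \<in> D \<longrightarrow> p \<noteq> q \<longrightarrow> (s, d) \<in> D \<longrightarrow> d \<le> c"
  have "?I D"
  proof (rule KD_invariant[OF assms(1) D])
    fix D r q c assume I: "?I D" and dr: "can_drop D r q c"
    have rc: "(r, c) \<in> D" using dr by (simp add: can_drop_def)
    show "?I (drop_cell D r q c)"
    proof (intro allI impI)
      fix p1 p2 c' s d
      let ?E = "drop_cell D r q c"
      assume *: "(p1, c') \<in> ?E" "(p2, c') \<in> ?E" "p1 \<noteq> p2" "(s, d) \<in> ?E"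
      have "\<exists>p1 p2. (p1, c') \<in> D \<and> (p2, c') \<in> D \<and> p1 \<noteq> p2"
        using *(1-3) rc by (auto simp: drop_cell_def)
      moreover have "\<exists>s. (s, d) \<in> D" using *(4) rc by (auto simp: drop_cell_def)
      ultimately show "d \<le> c'" using I by blast
    qed
  qed (use assms in blast)
  moreover have "(q + 1, c) \<in> D" "(r, c) \<in> D"
    using dr by (auto simp: can_drop_def)
  ultimately show "d \<le> c" using dr by (metis less_irrefl)
qed

section \<open>Chains of unit drops\<close>

definition unit_step :: "diagram \<Rightarrow> diagram \<Rightarrow> bool" where
  "unit_step D E \<longleftrightarrow> kohnert_step D E \<and> rowsum D = rowsum E + 1"

lemma unit_steps_KD:
  assumes "unit_step\<^sup>*\<^sup>* D E" "D \<in> KD D0"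
  shows "E \<in> KD D0"
  using assms by (induction rule: rtranclp_induct) (auto simp: unit_step_def KD_step)

text \<open>Every unit step is a cover, so along such chains any rank function is forced to change
  exactly as \<open>rowsum\<close> does.\<close>

lemma unit_steps_rank:
  assumes "is_rank_function (KD D0) (kohnert_le D0) \<rho>" "finite D0"
    and "unit_step\<^sup>*\<^sup>* D E" "D \<in> KD D0"
  shows "\<rho> D - \<rho> E = int (rowsum D) - int (rowsum E)"
  using assms(3,4)
proof (induction rule: rtranclp_induct)
  case (step E F)
  have E: "E \<in> KD D0" using unit_steps_KD step by blast
  have F: "kohnert_step E F" "rowsum E = rowsum F + 1"
    using step by (auto simp: unit_step_def)
  have "\<rho> E = \<rho> F + 1"
    using unit_gap_covered_by[OF assms(2) step_strictly_below[OF E F(1)] F(2)]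
      KD_step[OF E F(1)] assms(1) E F(2)
    by (fastforce simp: is_rank_function_def)
  then show ?case using step F by simp
qed simp

text \<open>The tool for building chains: a right end \<open>R\<close> of row \<open>n + 1\<close>
  above free positions descends one row, its cells dropping from right to left.\<close>

lemma unit_steps_lower:
  assumes "finite R" "finite D" "1 \<le> n"
    and "R \<subseteq> row D (n + 1)" "R \<inter> row D n = {}"
    and "\<And>c d. c \<in> R \<Longrightarrow> d \<in> row D (n + 1) \<Longrightarrow> c \<le> d \<Longrightarrow> d \<in> R"
  shows "unit_step\<^sup>*\<^sup>* D (D - {n + 1} \<times> R \<union> {n} \<times> R)"
  using assms(1,4-)
\<comment> \<open>This rule inserts an element smaller than all earlier ones, so \<open>c\<close>
  drops after all of \<open>R\<close>, as the moves demand.\<close>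
proof (induction rule: finite_linorder_min_induct)
  case (insert c R)
  define E where "E = D - {n + 1} \<times> R \<union> {n} \<times> R"
  have "unit_step\<^sup>*\<^sup>* D E"
    unfolding E_def
  proof (rule insert.IH)
    fix x d assume x: "x \<in> R" "d \<in> row D (n + 1)" "x \<le> d"
    then have "d \<in> insert c R" using insert.prems(3) by blast
    then show "d \<in> R" using x insert.hyps by auto
  qed (use insert.prems in auto)
  moreover have E: "finite E" using assms(2) insert.hyps by (simp add: E_def)
  have "can_drop E (n + 1) n c"
    unfolding can_drop_def
  proof (intro conjI allI impI)
    show "(n + 1, c) \<in> E" "(n, c) \<notin> E"
      using insert.prems insert.hyps by (auto simp: E_def row_def)
    show "d \<le> c" if "(n + 1, d) \<in> E" for d
    proof (rule ccontr)
      assume "\<not> d \<le> c"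
      then have "d \<in> insert c R"
        using that insert.prems(3)[of c d] by (auto simp: E_def row_def)
      then show False using that \<open>\<not> d \<le> c\<close> by (auto simp: E_def)
    qed
  qed (use assms(3) in auto)
  then have "unit_step E (drop_cell E (n + 1) n c)"
    using can_drop_step[OF E] rowsum_drop_cell[OF E] by (fastforce simp: unit_step_def)
  moreover have "drop_cell E (n + 1) n c = D - {n + 1} \<times> insert c R \<union> {n} \<times> insert c R"
    using insert.hyps by (auto simp: E_def drop_cell_def)
  ultimately show ?case by (metis rtranclp.rtrancl_into_rtrancl)
qed simp

lemma unit_steps_lower_row:
  assumes "finite A" "finite B" "1 \<le> n"
  shows "unit_step\<^sup>*\<^sup>* ({n} \<times> A \<union> {n + 1 + k} \<times> B) ({n} \<times> A \<union> {n + 1} \<times> B)"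
proof (induction k)
  case (Suc k)
  let ?D = "{n} \<times> A \<union> {n + 1 + Suc k} \<times> B"
  have "unit_step\<^sup>*\<^sup>* ?D (?D - {n + 1 + k + 1} \<times> B \<union> {n + 1 + k} \<times> B)"
    using assms by (intro unit_steps_lower) (auto simp: row_def)
  moreover have "?D - {n + 1 + k + 1} \<times> B \<union> {n + 1 + k} \<times> B = {n} \<times> A \<union> {n + 1 + k} \<times> B"
    by auto
  ultimately show ?case using Suc by (simp only: rtranclp_trans)
qed simp

section \<open>Covers that skip a row\<close>

lemma blocked_drop_covered_by:
  assumes fin: "finite D0" and y: "y \<in> KD D0"
    and "can_drop y (n + 1) (n - 1) a" "2 \<le> n" "(n, e) \<in> y" "a < e"
  shows "covered_by (KD D0) (kohnert_le D0) (drop_cell y (n + 1) (n - 1) a) y"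
proof -
  let ?x = "drop_cell y (n + 1) (n - 1) a"
  have finy: "finite y" using KD_finite fin y by blast
  have na: "(n, a) \<in> y" using assms(3,4) by (auto simp: can_drop_def)
  have ne: "?x \<noteq> y" using assms(3) by (auto simp: can_drop_def drop_cell_def)
  have sum: "rowsum y = rowsum ?x + 2"
    using rowsum_drop_cell[OF finy assms(3)] assms(4) by simp
  have "\<not> (strictly_below (kohnert_le D0) ?x z \<and> strictly_below (kohnert_le D0) z y)" for z
  proof
    assume z: "strictly_below (kohnert_le D0) ?x z \<and> strictly_below (kohnert_le D0) z y"
    have sz: "rowsum y = rowsum z + 1" "rowsum z = rowsum ?x + 1"
      using z strictly_below_rowsum[OF fin, of ?x z] strictly_below_rowsum[OF fin, of z y] sum
      by linarith+
    obtain q c where 1: "can_drop y (q + 1) q c" and zeq: "z = drop_cell y (q + 1) q c"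
      using unit_gap_drop[OF fin conjunct2[OF z] sz(1)] by blast
    obtain t d where "can_drop z (t + 1) t d" and xeq: "?x = drop_cell z (t + 1) t d"
      using unit_gap_drop[OF fin conjunct1[OF z] sz(2)] by blast
    show False
    \<comment> \<open>An intermediate \<open>z\<close> would split the drop into two unit drops. If
      the position vacated first stays empty in \<open>?x\<close>, it is \<open>(n + 1, a)\<close>,
      whose unit drop is stopped by \<open>(n, a)\<close>.\<close>
    proof (cases "(q + 1, c) \<in> ?x")
      case False
      then have "(q + 1, c) = (n + 1, a)" using 1 by (auto simp: drop_cell_def can_drop_def)
      then show False using 1 na by (auto simp: can_drop_def)
    next
      case True
      \<comment> \<open>Otherwise the second drop must refill the vacated position. Then
        \<open>(q, c)\<close> is the only new cell of \<open>?x\<close>, so the first drop moved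
        \<open>(n, a)\<close>, which is not last in row \<open>n\<close>.\<close>
      then have "(t, d) = (q + 1, c)"
        unfolding xeq using 1 by (auto simp: zeq drop_cell_def can_drop_def)
      then have "(q, c) \<in> ?x" unfolding xeq zeq by (auto simp: drop_cell_def)
      then have "(q + 1, c) = (n, a)" using 1 assms(4) by (auto simp: drop_cell_def can_drop_def)
      then show False using 1 assms(5,6) by (auto simp: can_drop_def)
    qed
  qed
  then show ?thesis
    unfolding covered_by_def using step_strictly_below[OF y can_drop_step[OF finy assms(3)] ne]
    by blast
qed

text \<open>Both routes from \<open>S\<close> to \<open>x\<close> lose the same rowsum, but on the
  route through \<open>y\<close> the cover that skips a row takes 2 from \<open>rowsum\<close> and
  only 1 from \<rho>.\<close>

lemma not_ranked_if_blocked_drop: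
  assumes "finite D0" "S \<in> KD D0"
    and "unit_step\<^sup>*\<^sup>* S y" "can_drop y (n + 1) (n - 1) a" "2 \<le> n" "(n, e) \<in> y" "a < e"
    and "unit_step\<^sup>*\<^sup>* (drop_cell y (n + 1) (n - 1) a) x" "unit_step\<^sup>*\<^sup>* S x"
  shows "\<not> ranked (KD D0) (kohnert_le D0)"
proof
  assume "ranked (KD D0) (kohnert_le D0)"
  then obtain \<rho> where \<rho>: "is_rank_function (KD D0) (kohnert_le D0) \<rho>"
    by (auto simp: ranked_def)
  let ?w = "drop_cell y (n + 1) (n - 1) a"
  have y: "y \<in> KD D0" "finite y" using unit_steps_KD KD_finite assms(1-3) by blast+
  have w: "?w \<in> KD D0" using KD_step can_drop_step y assms(4) by blast
  have "\<rho> y = \<rho> ?w + 1"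
    using blocked_drop_covered_by[OF assms(1) y(1) assms(4-7)] \<rho> y w
    by (auto simp: is_rank_function_def)
  moreover have "rowsum y = rowsum ?w + 2"
    using rowsum_drop_cell[OF y(2) assms(4)] assms(5) by simp
  ultimately show False
    using unit_steps_rank[OF \<rho> assms(1) assms(3) assms(2)] unit_steps_rank[OF \<rho> assms(1) assms(8) w]
      unit_steps_rank[OF \<rho> assms(1) assms(9) assms(2)] by simp
qed

lemma not_ranked_if_cell_right_of_double:
  assumes fin: "finite D0" and S: "S = {n} \<times> A \<union> {n + 1} \<times> B" "S \<in> KD D0"
    and n: "2 \<le> n" and a: "a \<in> A" "a \<in> B" and e: "e \<in> A \<union> B" "a < e"
  shows "\<not> ranked (KD D0) (kohnert_le D0)"
proof -
  define m where "m = n - 1"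
  have nm: "n = m + 1" "1 \<le> m" using n by (auto simp: m_def)
  have pred: "n - 1 = m" by (simp add: m_def)
  have "finite S" using KD_finite fin S by blast
  then have AB: "finite A" "finite B"
    using finite_row[of S n] finite_row[of S "n + 1"] by (auto simp: S(1) row_def)
  \<comment> \<open>Primed sets include column \<open>a\<close>, unprimed ones do not. In
    \<open>?x\<close> all cells of \<open>S\<close> in columns from \<open>a\<close> on are one row
    lower; the lower row descends first to make room.\<close>
  let ?A = "{c \<in> A. a < c}" and ?A' = "{c \<in> A. a \<le> c}"
  let ?B = "{c \<in> B. a < c}" and ?B' = "{c \<in> B. a \<le> c}"
  let ?x = "{m} \<times> ?A' \<union> {n} \<times> (A - ?A' \<union> ?B') \<union> {n + 1} \<times> (B - ?B')"
  have x: "unit_step\<^sup>*\<^sup>* S ?x"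
  proof -
    let ?D = "S - {m + 1} \<times> ?A' \<union> {m} \<times> ?A'"
    have "unit_step\<^sup>*\<^sup>* S ?D"
      using AB \<open>finite S\<close> nm by (intro unit_steps_lower) (auto simp: S(1) row_def)
    moreover have "unit_step\<^sup>*\<^sup>* ?D (?D - {n + 1} \<times> ?B' \<union> {n} \<times> ?B')"
      using AB \<open>finite S\<close> nm by (intro unit_steps_lower) (auto simp: S(1) row_def)
    moreover have "?D - {n + 1} \<times> ?B' \<union> {n} \<times> ?B' = ?x"
      using nm by (auto simp: S(1))
    ultimately show ?thesis by (simp only: rtranclp_trans)
  qed
  show ?thesis
  proof (cases "\<exists>d\<in>B. a < d")
    case True
    then obtain d where d: "d \<in> B" "a < d" by blast
    \<comment> \<open>Only the columns right of \<open>a\<close> have descended. Now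
      \<open>(n + 1, a)\<close> is last in its row, and \<open>d\<close> has reached row
      \<open>n\<close>, where it blocks \<open>(n, a)\<close>.\<close>
    let ?y = "{m} \<times> ?A \<union> {n} \<times> (A - ?A \<union> ?B) \<union> {n + 1} \<times> (B - ?B)"
    let ?D = "S - {m + 1} \<times> ?A \<union> {m} \<times> ?A"
    have "unit_step\<^sup>*\<^sup>* S ?D"
      using AB \<open>finite S\<close> nm by (intro unit_steps_lower) (auto simp: S(1) row_def)
    moreover have "unit_step\<^sup>*\<^sup>* ?D (?D - {n + 1} \<times> ?B \<union> {n} \<times> ?B)"
      using AB \<open>finite S\<close> nm by (intro unit_steps_lower) (auto simp: S(1) row_def)
    moreover have "?D - {n + 1} \<times> ?B \<union> {n} \<times> ?B = ?y"
      using nm by (auto simp: S(1))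
    ultimately have y: "unit_step\<^sup>*\<^sup>* S ?y" by (simp only: rtranclp_trans)
    \<comment> \<open>As sets, dropping \<open>(n + 1, a)\<close> past \<open>(n, a)\<close> equals
      lowering both by one row, so \<open>?x\<close> is reached at once.\<close>
    have eq: "drop_cell ?y (n + 1) m a = ?x"
      using a nm by (auto simp: drop_cell_def le_less)
    show ?thesis
    proof (rule not_ranked_if_blocked_drop[OF fin S(2) y _ n _ d(2) _ x])
      show "can_drop ?y (n + 1) (n - 1) a"
        unfolding pred using a nm by (auto simp: can_drop_def)
      show "(n, d) \<in> ?y" using d by simp
    qed (simp only: pred eq rtranclp.rtrancl_refl)
  next
    case False
    \<comment> \<open>Here \<open>a\<close> is already last in the upper row, so \<open>S\<close>
      itself takes the place of \<open>y\<close>, with \<open>e\<close> in row \<open>n\<close> as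
      the blocker.\<close>
    then have B: "\<And>c. c \<in> B \<Longrightarrow> c \<le> a" and eA: "e \<in> A" using e by (auto simp: not_less)
    let ?w = "drop_cell S (n + 1) m a"
    have "unit_step\<^sup>*\<^sup>* ?w (?w - {m + 1} \<times> ?A \<union> {m} \<times> ?A)"
      using AB \<open>finite S\<close> nm
      by (intro unit_steps_lower) (auto simp: S(1) row_def drop_cell_def)
    moreover have "?w - {m + 1} \<times> ?A \<union> {m} \<times> ?A = ?x"
      using a nm by (auto simp: S(1) drop_cell_def le_less dest: B)
    ultimately have w: "unit_step\<^sup>*\<^sup>* ?w ?x" by simp
    show ?thesis
    proof (rule not_ranked_if_blocked_drop[OF fin S(2) rtranclp.rtrancl_refl _ n _ e(2) _ x])
      show "can_drop S (n + 1) (n - 1) a"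
        unfolding pred using a nm B by (auto simp: can_drop_def S(1))
      show "(n, e) \<in> S" using eA by (simp add: S(1))
    qed (simp only: pred w)
  qed
qed

theorem theorem5p9:
  fixes D0 :: diagram and r1 r2 :: nat
  assumes "two_row_diagram D0 r1 r2"
  shows "(ranked (KD D0) (kohnert_le D0) \<longleftrightarrow>
            r1 = 1 \<or>
            (r1 > 1 \<and> Col_right D0 r1 r2 r1 \<union> Col_right D0 r1 r2 r2 = {} \<and>
             card (Col_both D0 r1 r2) \<le> 1)) \<and>
         (ranked (KD D0) (kohnert_le D0) \<longrightarrow>
            is_rank_function (KD D0) (kohnert_le D0) (rk D0))"
    (is "(?ranked \<longleftrightarrow> ?a \<or> ?b) \<and> _")
proof -
  have fin: "finite D0" and lt: "r1 < r2" and pos: "\<And>r c. (r, c) \<in> D0 \<Longrightarrow> 1 \<le> r"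
    and ne: "nonempty_rows D0 = {r1, r2}"
    using assms by (auto simp: two_row_diagram_def is_diagram_def)
  have rows: "r = r1 \<or> r = r2" if "(r, c) \<in> D0" for r c
    using ne that by (auto simp: nonempty_rows_def row_def)
  have "r1 \<in> nonempty_rows D0" by (simp add: ne)
  then have r1: "1 \<le> r1" using pos by (auto simp: nonempty_rows_def row_def)
  let ?A = "row D0 r1" and ?B = "row D0 r2"
  have AB: "finite ?A" "finite ?B" using fin finite_row by blast+
  have D0: "D0 = {r1} \<times> ?A \<union> {r2} \<times> ?B" using rows by (auto simp: row_def)
  have both: "Col_both D0 r1 r2 = ?A \<inter> ?B" by (simp add: Col_both_def)
  have fboth: "finite (Col_both D0 r1 r2)" using AB by (simp add: both)
  have rank: "is_rank_function (KD D0) (kohnert_le D0) (rk D0)" if "?a \<or> ?b"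
    using that
  proof
    assume "?a"
    then show ?thesis
      using rows lt by (intro rank_function_if_bottom_row[OF fin]) (metis less_asym)
  next
    assume b: "?b"
    show ?thesis
    proof (rule rank_function_if_double_rightmost[OF fin])
      fix p q c s d
      assume *: "(p, c) \<in> D0" "(q, c) \<in> D0" "p \<noteq> q" "(s, d) \<in> D0"
      have c: "c \<in> Col_both D0 r1 r2" using * rows by (auto simp: both row_def)
      have single: "x = c" if "x \<in> Col_both D0 r1 r2" for x
        using b fboth c that by (auto simp: card_le_Suc0_iff_eq)
      have Max: "Max (Col_both D0 r1 r2) = c"
        \<comment> \<open>With \<open>c\<close> the only doubled column, emptiness of both
          \<open>Col_right\<close> sets bounds all remaining columns by \<open>c\<close>.\<close>
        using c fboth by (intro Max_eqI) (auto dest: single)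
      show "d \<le> c"
      proof (cases "d \<in> Col_both D0 r1 r2")
        case False
        then have "d \<in> Col_only D0 s" "s = r1 \<or> s = r2"
          using *(4) rows by (auto simp: Col_only_def both row_def)
        then show ?thesis using b c Max by (auto simp: Col_right_def split: if_splits)
      qed (auto dest: single)
    qed
  qed
  have "?a \<or> ?b" if ?ranked
  proof (rule ccontr)
    assume not: "\<not> (?a \<or> ?b)"
    then have gt: "2 \<le> r1" using r1 by simp
    \<comment> \<open>If at most one column is doubled, some \<open>Col_right\<close> set supplies
      \<open>e\<close>, and \<open>a\<close> is the maximal doubled column. Otherwise
      \<open>a < e\<close> are two doubled columns.\<close>
    obtain a e where ae: "a \<in> ?A" "a \<in> ?B" "e \<in> ?A \<union> ?B" "a < e"
    proof (cases "card (Col_both D0 r1 r2) \<le> 1")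
      case True
      then obtain e s where e: "e \<in> Col_right D0 r1 r2 s" "s = r1 \<or> s = r2"
        using not gt by auto
      then have "Col_both D0 r1 r2 \<noteq> {}" by (auto simp: Col_right_def split: if_splits)
      then have "Max (Col_both D0 r1 r2) \<in> Col_both D0 r1 r2" using fboth Max_in by blast
      then show ?thesis using that e \<open>Col_both D0 r1 r2 \<noteq> {}\<close>
        by (auto simp: Col_right_def both Col_only_def row_def)
    next
      case False
      then obtain x y where "x \<in> ?A \<inter> ?B" "y \<in> ?A \<inter> ?B" "x \<noteq> y"
        using fboth by (auto simp: card_le_Suc0_iff_eq both)
      then show ?thesis using that by (metis IntD1 IntD2 UnI1 linorder_neqE_nat)
    qed
    have "unit_step\<^sup>*\<^sup>* D0 ({r1} \<times> ?A \<union> {r1 + 1} \<times> ?B)"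
      \<comment> \<open>The gap \<open>r2 - (r1 + 1)\<close> counts the empty rows between the two
        given ones.\<close>
      using unit_steps_lower_row[OF AB r1, of "r2 - (r1 + 1)"] lt D0 by simp
    then have "{r1} \<times> ?A \<union> {r1 + 1} \<times> ?B \<in> KD D0" using unit_steps_KD KD_refl by blast
    then show False
      using not_ranked_if_cell_right_of_double[OF fin refl _ gt ae] that by blast
  qed
  then show ?thesis using rank by (auto simp: ranked_def)
qed

end
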